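(* Let $(S,\mathcal{S},\mu)$ be a measure space where $\mu$ is atomless and $\sigma$-finite, and let $\xi$ be a $\mu$-swap-invariant random measure on $S$ such that the intensity measure $\mathbf{E}\,\xi$ is $\sigma$-finite. Then $\mathbf{E}\,\xi=c\,\mu$ for some $c\in[0,\infty)$.
   Context: A random measure $\xi$ on a measurable space $(S,\mathcal{S})$, defined over a probability space $(\Omega,\mathcal{F},\mathbf{P})$, is a map $\xi:\Omega\times\mathcal{S}\to[0,\infty]$ such that $\xi(M)=\xi(\cdot,M)$ is measurable for each $M\in\mathcal{S}$ and $\xi(\omega,\cdot)$ is a measure for each $\omega\in\Omega$. Its intensity measure $\mathbf{E}\,\xi$ is $M\mapsto\mathbf{E}\,\xi(M)$. Atomless: an atom of $\mu$ is a measurable set $M$ with $\mu(M)>0$ such that every measurable $C\subset M$ satisfies $\mu(C)=0$ or $\mu(C)=\mu(M)$; $\mu$ is atomless if it has no atoms. $\mu$-swap-invariant: $\mathbf{E}\,\big|\sum_{j=1}^n u_j\xi(A_j)\big|=\mathbf{E}\,\big|\sum_{j=1}^n u_j\xi(B_j)\big|$ for all $n\ge1$, $u\in\mathbb{R}^n$, disjoint $A_1,\dots,A_n\in\mathcal{S}$ and disjoint $B_1,\dots,B_n\in\mathcal{S}$ such that $\mu(A_j)=\mu(B_j)$, $\mathbf{E}\,\xi(A_j)<\infty$ and $\mathbf{E}\,\xi(B_j)<\infty$ for $1\le j\le n$. *)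

theory Defs
  imports "HOL-Probability.Probability"
begin

definition measure_atom :: "'a measure \<Rightarrow> 'a set \<Rightarrow> bool" where
  "measure_atom \<mu> M \<longleftrightarrow> M \<in> sets \<mu> \<and> emeasure \<mu> M > 0 \<and>
     (\<forall>C\<in>sets \<mu>. C \<subseteq> M \<longrightarrow> emeasure \<mu> C = 0 \<or> emeasure \<mu> C = emeasure \<mu> M)"

definition atomless :: "'a measure \<Rightarrow> bool" where
  "atomless \<mu> \<longleftrightarrow> (\<forall>M. \<not> measure_atom \<mu> M)"

text \<open>Only the \<open>\<sigma>\<close>-algebra of \<open>S\<close> matters in the next two definitions, not the measure it carries.\<close>

definition random_measure :: "'w measure \<Rightarrow> 'a measure \<Rightarrow> ('w \<Rightarrow> 'a measure) \<Rightarrow> bool" where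
  "random_measure P S \<xi> \<longleftrightarrow> prob_space P \<and>
     (\<forall>\<omega>\<in>space P. sets (\<xi> \<omega>) = sets S) \<and>
     (\<forall>M\<in>sets S. (\<lambda>\<omega>. emeasure (\<xi> \<omega>) M) \<in> borel_measurable P)"

definition intensity :: "'w measure \<Rightarrow> 'a measure \<Rightarrow> ('w \<Rightarrow> 'a measure) \<Rightarrow> 'a measure" where
  "intensity P S \<xi> = measure_of (space S) (sets S) (\<lambda>M. \<integral>\<^sup>+\<omega>. emeasure (\<xi> \<omega>) M \<partial>P)"

lemma sets_intensity [simp]: "sets (intensity P S \<xi>) = sets S"
  by (simp add: intensity_def)

lemma space_intensity [simp]: "space (intensity P S \<xi>) = space S"
  by (simp add: intensity_def)

lemma emeasure_intensity:
  assumes "random_measure P S \<xi>" and "M \<in> sets S"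
  shows "emeasure (intensity P S \<xi>) M = (\<integral>\<^sup>+\<omega>. emeasure (\<xi> \<omega>) M \<partial>P)"
proof (rule emeasure_measure_of[OF intensity_def])
  let ?m = "\<lambda>M. \<integral>\<^sup>+\<omega>. emeasure (\<xi> \<omega>) M \<partial>P"
  show "sets S \<subseteq> Pow (space S)" by (rule sets.space_closed)
  show "M \<in> sets (intensity P S \<xi>)" using assms by simp
  show "positive (sets (intensity P S \<xi>)) ?m" by (simp add: positive_def)
  show "countably_additive (sets (intensity P S \<xi>)) ?m"
  proof (rule countably_additiveI)
    fix A :: "nat \<Rightarrow> 'b set"
    assume A: "range A \<subseteq> sets (intensity P S \<xi>)" "disjoint_family A"
    have "(\<Sum>i. ?m (A i)) = (\<integral>\<^sup>+\<omega>. (\<Sum>i. emeasure (\<xi> \<omega>) (A i)) \<partial>P)"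
      using assms(1) A(1) by (intro nn_integral_suminf[symmetric]) (auto simp: random_measure_def)
    also have "\<dots> = ?m (\<Union>i. A i)"
      using assms(1) A by (intro nn_integral_cong suminf_emeasure) (auto simp: random_measure_def)
    finally show "(\<Sum>i. ?m (A i)) = ?m (\<Union>i. A i)" .
  qed
qed

text \<open>In the sums below, \<^term>\<open>measure (\<xi> \<omega>) M\<close> is the real value of \<^term>\<open>emeasure (\<xi> \<omega>) M\<close>.
  The two differ only where the latter is infinite, which is a null event since the expectation is
  required to be finite.\<close>

definition swap_invariant :: "'w measure \<Rightarrow> 'a measure \<Rightarrow> ('w \<Rightarrow> 'a measure) \<Rightarrow> bool" where
  "swap_invariant P \<mu> \<xi> \<longleftrightarrow>
     (\<forall>n\<ge>1. \<forall>(u :: nat \<Rightarrow> real) (A :: nat \<Rightarrow> 'a set) (B :: nat \<Rightarrow> 'a set).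
        (\<forall>j\<in>{1..n}. A j \<in> sets \<mu> \<and> B j \<in> sets \<mu>) \<longrightarrow>
        disjoint_family_on A {1..n} \<longrightarrow> disjoint_family_on B {1..n} \<longrightarrow>
        (\<forall>j\<in>{1..n}. emeasure \<mu> (A j) = emeasure \<mu> (B j) \<and>
           (\<integral>\<^sup>+\<omega>. emeasure (\<xi> \<omega>) (A j) \<partial>P) < \<infinity> \<and>
           (\<integral>\<^sup>+\<omega>. emeasure (\<xi> \<omega>) (B j) \<partial>P) < \<infinity>) \<longrightarrow>
        (\<integral>\<^sup>+\<omega>. ennreal \<bar>\<Sum>j=1..n. u j * measure (\<xi> \<omega>) (A j)\<bar> \<partial>P) =
        (\<integral>\<^sup>+\<omega>. ennreal \<bar>\<Sum>j=1..n. u j * measure (\<xi> \<omega>) (B j)\<bar> \<partial>P))"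

end

theory Submission
  imports Defs
begin

text \<open>Taking \<open>n = 1\<close> in swap-invariance, \<open>\<nu> = E \<xi>\<close> gives equal mass to sets of equal \<open>\<mu>\<close>-mass
  (whenever \<open>\<nu>\<close> is finite on them); comparison with the empty set gives \<open>\<nu> \<lless> \<mu>\<close>. Let \<open>f\<close> be the
  Radon-Nikodym density. If \<open>f \<le> c\<close> on a set and \<open>f \<ge> c\<close> on another, both of positive
  \<open>\<mu>\<close>-mass, then by Sierpinski's theorem on the range of atomless measures both contain subsets of
  a common finite positive \<open>\<mu>\<close>-mass; these have the same \<open>\<nu>\<close>-mass, so neither inequality is strict.
  With \<open>c = \<nu>(A) / \<mu>(A)\<close> for one suitable set \<open>A\<close>, this forces \<open>f = c\<close> almost everywhere.\<close>

section \<open>Sierpinski's theorem on the range of an atomless measure\<close>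

text \<open>A set of finite positive measure that is not an atom splits into two parts of positive
  measure, and the smaller part has at most half of the mass. Iterating this \<open>n\<close> times
  gives the bound.\<close>

lemma atomless_small_subset:
  assumes "atomless M" and A: "A \<in> fmeasurable M" "measure M A > 0"
  shows "\<exists>C\<in>sets M. C \<subseteq> A \<and> 0 < measure M C \<and> measure M C \<le> measure M A / 2 ^ n"
proof (induction n)
  case 0
  then show ?case using A by (auto intro!: bexI[of _ A])
next
  case (Suc n)
  then obtain C where C: "C \<in> sets M" "C \<subseteq> A" "0 < measure M C" "measure M C \<le> measure M A / 2 ^ n"
    by blast
  have Cf: "C \<in> fmeasurable M"
    using fmeasurableI2[OF A(1) C(2,1)] .
  have "\<not> measure_atom M C"
    using assms(1) by (simp add: atomless_def)
  moreover have "emeasure M C > 0"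
    using C(3) by (metis measure_def enn2real_0 less_irrefl zero_less_iff_neq_zero)
  ultimately obtain D where D: "D \<in> sets M" "D \<subseteq> C" "emeasure M D \<noteq> 0" "emeasure M D \<noteq> emeasure M C"
    using C(1) by (auto simp: measure_atom_def)
  have Df: "D \<in> fmeasurable M"
    using fmeasurableI2[OF Cf D(2,1)] .
  have D0: "measure M D > 0" "measure M D \<noteq> measure M C"
    using D Df Cf by (auto simp: emeasure_eq_measure2 zero_less_measure_iff)
  have "measure M D \<le> measure M C"
    using D Cf by (intro measure_mono_fmeasurable) auto
  moreover have "measure M (C - D) = measure M C - measure M D"
    using D Cf Df by (intro measurable_measure_Diff) auto
  ultimately have E: "measure M (C - D) > 0" "measure M D + measure M (C - D) = measure M C"
    using D0 by auto
  show ?case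
  proof (cases "measure M D \<le> measure M C / 2")
    case True
    then show ?thesis using C D D0 by (intro bexI[of _ D]) auto
  next
    case False
    then show ?thesis using C D E by (intro bexI[of _ "C - D"]) auto
  qed
qed

text \<open>Greedy exhaustion: sets grow within the budget \<open>t\<close>, each step gaining at
  least half of the supremum of the admissible gains. If the union \<open>U\<close> had mass below
  \<open>t\<close>, a small enough set outside \<open>U\<close> would stay admissible at every stage
  and keep the increments away from 0, although they tend to 0.\<close>

theorem atomless_intermediate_value:
  assumes "atomless M" and A: "A \<in> fmeasurable M" and t: "0 \<le> t" "t \<le> measure M A"
  shows "\<exists>C\<in>sets M. C \<subseteq> A \<and> measure M C = t"
proof -
  define adm where "adm C D \<longleftrightarrow> D \<in> sets M \<and> D \<subseteq> A - C \<and> measure M C + measure M D \<le> t" for C D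
  have fm: "X \<in> fmeasurable M" if "X \<in> sets M" "X \<subseteq> A" for X
    using fmeasurableI2[OF A] that by blast
  have "\<exists>C :: nat \<Rightarrow> 'a set. \<forall>n. (C n \<in> sets M \<and> C n \<subseteq> A \<and> measure M (C n) \<le> t) \<and>
      (C n \<subseteq> C (Suc n) \<and>
        (\<forall>D. adm (C n) D \<longrightarrow> measure M D \<le> 2 * (measure M (C (Suc n)) - measure M (C n))))"
  proof (intro dependent_nat_choice allI impI conjI)
    show "\<exists>C. C \<in> sets M \<and> C \<subseteq> A \<and> measure M C \<le> t"
      using t by (intro exI[of _ "{}"]) auto
  next
    fix C assume C: "C \<in> sets M \<and> C \<subseteq> A \<and> measure M C \<le> t"
    define s where "s = (SUP D \<in> Collect (adm C). measure M D)"
    have bdd: "bdd_above (measure M ` Collect (adm C))"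
      unfolding adm_def bdd_above_def
      by (rule exI[of _ "t - measure M C"]) auto
    have le: "measure M D \<le> s" if "adm C D" for D
      unfolding s_def using that by (intro cSUP_upper bdd) auto
    have e: "adm C {}"
      using C by (auto simp: adm_def)
    \<comment> \<open>The supremum \<open>s\<close> need not be attained, so only half of it is
      asked for. If \<open>s\<close> is not positive, the empty set does.\<close>
    have "\<exists>D. adm C D \<and> s \<le> 2 * measure M D"
    proof (cases "s > 0")
      case True
      then have "s / 2 < (SUP D \<in> Collect (adm C). measure M D)"
        by (simp add: s_def)
      then obtain D where "adm C D" "s / 2 < measure M D"
        using e bdd by (subst (asm) less_cSUP_iff) auto
      then show ?thesis by (intro exI[of _ D]) auto
    next
      case False
      then show ?thesis using e by (intro exI[of _ "{}"]) auto
    qed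
    then obtain D where D: "adm C D" "s \<le> 2 * measure M D" by blast
    have CD: "measure M (C \<union> D) = measure M C + measure M D"
    proof -
      have "C \<inter> D = {}"
        using D(1) unfolding adm_def by blast
      moreover have "C \<in> fmeasurable M" "D \<in> fmeasurable M"
        using C D(1) unfolding adm_def by (blast intro: fm)+
      ultimately show ?thesis
        by (simp add: measure_Un3)
    qed
    have "C \<union> D \<in> sets M" "C \<union> D \<subseteq> A" "measure M (C \<union> D) \<le> t"
      using C D(1) unfolding CD adm_def by auto
    moreover have "measure M E \<le> 2 * (measure M (C \<union> D) - measure M C)" if "adm C E" for E
      using le[OF that] D(2) by (simp add: CD)
    ultimately show "\<exists>C'. (C' \<in> sets M \<and> C' \<subseteq> A \<and> measure M C' \<le> t) \<and> C \<subseteq> C' \<and>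
        (\<forall>D. adm C D \<longrightarrow> measure M D \<le> 2 * (measure M C' - measure M C))"
      by blast
  qed
  then obtain C :: "nat \<Rightarrow> 'a set"
    where C: "\<And>n. C n \<in> sets M" "\<And>n. C n \<subseteq> A" "\<And>n. measure M (C n) \<le> t"
      and inc: "\<And>n. C n \<subseteq> C (Suc n)"
      and greedy: "\<And>n D. adm (C n) D \<Longrightarrow> measure M D \<le> 2 * (measure M (C (Suc n)) - measure M (C n))"
    by blast
  define U where "U = (\<Union>n. C n)"
  have U: "U \<in> sets M" "U \<subseteq> A"
    using C by (auto simp: U_def)
  have lim: "(\<lambda>n. measure M (C n)) \<longlonglongrightarrow> measure M U"
    unfolding U_def
    by (rule Lim_measure_incseq) (use C inc U fm[OF U] in \<open>auto simp: incseq_Suc_iff U_def fmeasurable_def\<close>)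
  have Ut: "measure M U \<le> t"
    using lim C(3) by (intro LIMSEQ_le_const2) auto
  have "\<not> measure M U < t"
  proof
    assume lt: "measure M U < t"
    have diff: "measure M (A - U) = measure M A - measure M U"
      using U A fm[OF U] by (intro measurable_measure_Diff) auto
    have "A - U \<in> fmeasurable M"
      using U A by (intro fmeasurable_Diff) auto
    moreover have pos: "measure M (A - U) > 0"
      using diff lt t by simp
    \<comment> \<open>This \<open>n\<close> makes the bound of \<open>atomless_small_subset\<close>
      on subsets of \<open>A - U\<close> smaller than the gap \<open>t - measure M U\<close>, so
      that \<open>D\<close> fits into the gap.\<close>
    moreover obtain n where n: "measure M (A - U) / (t - measure M U) < 2 ^ n"
      using real_arch_pow[of 2] by auto
    ultimately obtain D where D: "D \<in> sets M" "D \<subseteq> A - U" "0 < measure M D"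
      "measure M D \<le> measure M (A - U) / 2 ^ n"
      using atomless_small_subset[OF assms(1)] by blast
    have "measure M (A - U) / 2 ^ n < t - measure M U"
      using n lt by (simp add: field_simps)
    then have Dt: "measure M D + measure M U \<le> t"
      using D by linarith
    \<comment> \<open>\<open>D\<close> avoids every \<open>C k\<close> and fits even beside
      \<open>U\<close>, so it is admissible at all stages at once; \<open>greedy\<close> then bounds
      all increments below by the same positive number.\<close>
    have "measure M (C k) \<le> measure M U" for k
      by (intro measure_mono_fmeasurable) (use C fm[OF U] in \<open>auto simp: U_def\<close>)
    then have "measure M (C k) + measure M D \<le> t" for k
      using Dt by (smt (verit))
    moreover have "D \<subseteq> A - C k" for k
      using D(2) by (auto simp: U_def)
    ultimately have "adm (C k) D" for k
      using D(1) by (simp add: adm_def)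
    then have ge: "measure M D \<le> 2 * (measure M (C (Suc k)) - measure M (C k))" for k
      using greedy by blast
    have "(\<lambda>k. 2 * (measure M (C (Suc k)) - measure M (C k))) \<longlonglongrightarrow> 2 * (measure M U - measure M U)"
      by (intro tendsto_intros lim LIMSEQ_Suc[OF lim])
    then have "measure M D \<le> 2 * (measure M U - measure M U)"
      by (rule LIMSEQ_le_const) (use ge in auto)
    then show False using D by simp
  qed
  then show ?thesis using U Ut by (intro bexI[of _ U]) auto
qed

section \<open>Subsets of finite positive mass\<close>

text \<open>Countably many sets of finite \<open>N\<close>-mass cover \<open>A\<close>; if each met
  \<open>A\<close> in an \<open>M\<close>-null set, \<open>A\<close> itself would be
  \<open>M\<close>-null.\<close>

lemma sigma_finite_positive_subset:
  assumes "sigma_finite_measure N" and [simp]: "sets N = sets M"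
    and A: "A \<in> sets M" "emeasure M A > 0"
  shows "\<exists>B\<in>sets M. B \<subseteq> A \<and> emeasure M B > 0 \<and> emeasure N B < \<infinity>"
proof -
  obtain F :: "nat \<Rightarrow> 'a set"
    where F: "range F \<subseteq> sets N" "(\<Union>i. F i) = space N" "\<And>i. emeasure N (F i) \<noteq> \<infinity>"
    using sigma_finite_measure.sigma_finite[OF assms(1)] by blast
  have sp: "space N = space M"
    by (intro sets_eq_imp_space_eq) simp
  have "\<exists>i. emeasure M (A \<inter> F i) \<noteq> 0"
  proof (rule ccontr)
    assume "\<not> ?thesis"
    then have "emeasure M (\<Union>i. A \<inter> F i) = 0"
      using A F(1) by (intro emeasure_UN_eq_0) auto
    moreover have "(\<Union>i. A \<inter> F i) = A"
      using F(2) sets.sets_into_space[OF A(1)] sp by auto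
    ultimately show False using A by simp
  qed
  then obtain i where i: "emeasure M (A \<inter> F i) \<noteq> 0" by blast
  have "emeasure N (A \<inter> F i) \<le> emeasure N (F i)"
    using F(1) by (intro emeasure_mono) auto
  then have "emeasure N (A \<inter> F i) < \<infinity>"
    using F(3)[of i] by (simp add: less_top order.strict_trans1)
  then show ?thesis
    using i A F(1) by (intro bexI[of _ "A \<inter> F i"]) (auto simp: zero_less_iff_neq_zero)
qed

text \<open>Cut first for \<open>N\<close>, then for \<open>M\<close>: shrinking further keeps the
  \<open>N\<close>-mass finite.\<close>

lemma sigma_finite_positive_subset2:
  assumes "sigma_finite_measure M" "sigma_finite_measure N" and "sets N = sets M"
    and "A \<in> sets M" "emeasure M A > 0"
  obtains B where "B \<in> sets M" "B \<subseteq> A" "emeasure M B > 0" "emeasure M B < \<infinity>" "emeasure N B < \<infinity>"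
proof -
  obtain C where C: "C \<in> sets M" "C \<subseteq> A" "emeasure M C > 0" "emeasure N C < \<infinity>"
    using sigma_finite_positive_subset[OF assms(2-5)] by blast
  obtain B where B: "B \<in> sets M" "B \<subseteq> C" "emeasure M B > 0" "emeasure M B < \<infinity>"
    using sigma_finite_positive_subset[OF assms(1) refl C(1,3)] by blast
  have "emeasure N B \<le> emeasure N C"
    using B C assms(3) by (intro emeasure_mono) auto
  then show thesis
    using that[of B] B C by (auto intro: order.strict_trans1)
qed

section \<open>Comparison of a density with a constant\<close>

text \<open>A function lying on one side of its mean equals the mean almost everywhere, because the
  difference is nonnegative with integral zero.\<close>

lemma nn_integral_indicator_eq_const_imp_AE:
  fixes f :: "'a \<Rightarrow> ennreal"
  assumes [measurable]: "f \<in> borel_measurable M" "A \<in> sets M"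
    and fin: "emeasure M A < \<infinity>" "c < \<infinity>"
    and eq: "(\<integral>\<^sup>+x. f x * indicator A x \<partial>M) = c * emeasure M A"
    and cmp: "(AE x in M. x \<in> A \<longrightarrow> f x \<le> c) \<or> (AE x in M. x \<in> A \<longrightarrow> c \<le> f x)"
  shows "AE x in M. x \<in> A \<longrightarrow> f x = c"
proof -
  have cA: "(\<integral>\<^sup>+x. c * indicator A x \<partial>M) = c * emeasure M A"
    by (simp add: nn_integral_cmult)
  have fin': "c * emeasure M A \<noteq> \<infinity>"
    using fin by (simp add: ennreal_mult_eq_top_iff less_top)
  from cmp show ?thesis
  proof
    assume le: "AE x in M. x \<in> A \<longrightarrow> f x \<le> c"
    \<comment> \<open>Subtraction on \<open>ennreal\<close> is truncated, so a zero difference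
      yields only \<open>c \<le> f x\<close> on \<open>A\<close>; the other inequality is
      \<open>le\<close>. Finiteness of the common integral lets the integrals be subtracted.\<close>
    have "AE x in M. c * indicator A x - f x * indicator A x = 0"
    proof (subst nn_integral_0_iff_AE[symmetric])
      show "(\<integral>\<^sup>+x. c * indicator A x - f x * indicator A x \<partial>M) = 0"
        using le eq fin' by (subst nn_integral_diff) (auto simp: cA split: split_indicator)
    qed simp
    with le show ?thesis
      by eventually_elim (auto simp: diff_eq_0_iff_ennreal split: split_indicator_asm)
  next
    assume ge: "AE x in M. x \<in> A \<longrightarrow> c \<le> f x"
    have "AE x in M. f x * indicator A x - c * indicator A x = 0"
    proof (subst nn_integral_0_iff_AE[symmetric])
      show "(\<integral>\<^sup>+x. f x * indicator A x - c * indicator A x \<partial>M) = 0"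
        using ge eq fin' by (subst nn_integral_diff) (auto simp: cA split: split_indicator)
    qed simp
    with ge show ?thesis
      by eventually_elim (auto simp: diff_eq_0_iff_ennreal split: split_indicator_asm)
  qed
qed

lemma emeasure_density_le_const:
  fixes f :: "'a \<Rightarrow> ennreal"
  assumes "f \<in> borel_measurable M" "A \<in> sets M" "\<And>x. x \<in> A \<Longrightarrow> f x \<le> c"
  shows "emeasure (density M f) A \<le> c * emeasure M A"
proof -
  have "emeasure (density M f) A = (\<integral>\<^sup>+x. f x * indicator A x \<partial>M)"
    using assms by (simp add: emeasure_density)
  also have "\<dots> \<le> (\<integral>\<^sup>+x. c * indicator A x \<partial>M)"
    using assms by (intro nn_integral_mono) (auto split: split_indicator)
  also have "\<dots> = c * emeasure M A"
    using assms by (simp add: nn_integral_cmult)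
  finally show ?thesis .
qed

lemma emeasure_density_ge_const:
  fixes f :: "'a \<Rightarrow> ennreal"
  assumes "f \<in> borel_measurable M" "A \<in> sets M" "\<And>x. x \<in> A \<Longrightarrow> c \<le> f x"
  shows "c * emeasure M A \<le> emeasure (density M f) A"
proof -
  have "c * emeasure M A = (\<integral>\<^sup>+x. c * indicator A x \<partial>M)"
    using assms by (simp add: nn_integral_cmult)
  also have "\<dots> \<le> (\<integral>\<^sup>+x. f x * indicator A x \<partial>M)"
    using assms by (intro nn_integral_mono) (auto split: split_indicator)
  also have "\<dots> = emeasure (density M f) A"
    using assms by (simp add: emeasure_density)
  finally show ?thesis .
qed

section \<open>Proportionality of two measures\<close>

lemma atomless_equal_mass_subsets:
  assumes "atomless M" "sigma_finite_measure M" "sigma_finite_measure N" and [simp]: "sets N = sets M"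
    and "A \<in> sets M" "B \<in> sets M" "emeasure M A > 0" "emeasure M B > 0"
  obtains A' B' where "A' \<in> sets M" "B' \<in> sets M" "A' \<subseteq> A" "B' \<subseteq> B"
    "emeasure M A' = emeasure M B'" "0 < emeasure M A'" "emeasure M A' < \<infinity>"
    "emeasure N A' < \<infinity>" "emeasure N B' < \<infinity>"
proof -
  obtain A1 where A1: "A1 \<in> sets M" "A1 \<subseteq> A" "emeasure M A1 > 0" "emeasure M A1 < \<infinity>" "emeasure N A1 < \<infinity>"
    using sigma_finite_positive_subset2[OF assms(2-4,5,7)] .
  obtain B1 where B1: "B1 \<in> sets M" "B1 \<subseteq> B" "emeasure M B1 > 0" "emeasure M B1 < \<infinity>" "emeasure N B1 < \<infinity>"
    using sigma_finite_positive_subset2[OF assms(2-4,6,8)] .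
  have fm: "A1 \<in> fmeasurable M" "B1 \<in> fmeasurable M"
    using A1 B1 by (auto simp: fmeasurable_def)
  \<comment> \<open>The smaller of the two masses lies in the range of \<open>M\<close> on subsets
    of both \<open>A1\<close> and \<open>B1\<close>.\<close>
  define t where "t = min (measure M A1) (measure M B1)"
  have pos: "0 < t"
    using A1 B1 fm by (auto simp: t_def emeasure_eq_measure2)
  obtain A2 where A2: "A2 \<in> sets M" "A2 \<subseteq> A1" "measure M A2 = t"
    using atomless_intermediate_value[OF assms(1) fm(1), of t] pos by (auto simp: t_def)
  obtain B2 where B2: "B2 \<in> sets M" "B2 \<subseteq> B1" "measure M B2 = t"
    using atomless_intermediate_value[OF assms(1) fm(2), of t] pos by (auto simp: t_def)
  have fm2: "A2 \<in> fmeasurable M" "B2 \<in> fmeasurable M"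
    using fmeasurableI2[OF fm(1) A2(2,1)] fmeasurableI2[OF fm(2) B2(2,1)] by auto
  have "emeasure N A2 \<le> emeasure N A1" "emeasure N B2 \<le> emeasure N B1"
    using A1 A2 B1 B2 by (auto intro!: emeasure_mono)
  then have "emeasure N A2 < \<infinity>" "emeasure N B2 < \<infinity>"
    using A1 B1 by (auto intro: order.strict_trans1)
  then show thesis
    using that[of A2 B2] A1 A2 B1 B2 fm2 pos by (auto simp: emeasure_eq_measure2)
qed

text \<open>The deterministic core: \<open>inv\<close> is what swap-invariance says about the
  intensity \<open>N\<close> when \<open>n = 1\<close>, with the same finiteness conditions.\<close>

lemma equal_mass_invariant_imp_scale_measure:
  assumes atl: "atomless M" and sfM: "sigma_finite_measure M" and sfN: "sigma_finite_measure N"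
    and sets [simp]: "sets N = sets M"
    and inv: "\<And>A B. A \<in> sets M \<Longrightarrow> B \<in> sets M \<Longrightarrow> emeasure M A = emeasure M B \<Longrightarrow>
      emeasure N A < \<infinity> \<Longrightarrow> emeasure N B < \<infinity> \<Longrightarrow> emeasure N A = emeasure N B"
  shows "\<exists>c::real. 0 \<le> c \<and> N = scale_measure (ennreal c) M"
proof -
  \<comment> \<open>A subset \<open>B\<close> of finite positive \<open>N\<close>-mass would be
    \<open>M\<close>-null like \<open>{}\<close>, so \<open>inv\<close> would give it
    \<open>N\<close>-mass 0.\<close>
  have null: "emeasure N A = 0" if "A \<in> sets M" "emeasure M A = 0" for A
  proof (rule ccontr)
    assume "emeasure N A \<noteq> 0"
    then have "emeasure N A > 0"
      by (simp add: zero_less_iff_neq_zero)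
    moreover have "A \<in> sets N"
      using that by simp
    ultimately obtain B where B: "B \<in> sets M" "B \<subseteq> A" "emeasure N B > 0" "emeasure N B < \<infinity>"
      using sigma_finite_positive_subset[OF sfN refl, of A] unfolding sets by blast
    have "emeasure M B \<le> emeasure M A"
      using that B by (intro emeasure_mono) auto
    then have "emeasure N B = emeasure N {}"
      using B that by (intro inv) auto
    then show False using B by simp
  qed
  then have ac: "absolutely_continuous M N"
    by (auto simp: absolutely_continuous_def null_sets_def)
  define f where "f = RN_deriv M N"
  have [measurable]: "f \<in> borel_measurable M"
    by (simp add: f_def)
  have N: "N = density M f"
    using sigma_finite_measure.density_RN_deriv[OF sfM ac sets] by (simp add: f_def)
  \<comment> \<open>The chain N(A') \<le> c M(A') = c M(B') \<le> N(B') = N(A') closes up, so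
    \<open>c\<close> is the mean of \<open>f\<close> over both sets whenever their common mass is
    positive.\<close>
  have sep: "AE x in M. x \<in> A' \<union> B' \<longrightarrow> f x = c"
    if "A' \<in> sets M" "B' \<in> sets M" "emeasure M A' = emeasure M B'" "emeasure M A' < \<infinity>"
      "emeasure N A' < \<infinity>" "emeasure N B' < \<infinity>" "c < \<infinity>"
      "\<And>x. x \<in> A' \<Longrightarrow> f x \<le> c" "\<And>x. x \<in> B' \<Longrightarrow> c \<le> f x" for A' B' c
  proof -
    have "emeasure N A' \<le> c * emeasure M A'"
      using that unfolding N by (intro emeasure_density_le_const) auto
    moreover have "c * emeasure M B' \<le> emeasure N B'"
      using that unfolding N by (intro emeasure_density_ge_const) auto
    moreover have "emeasure N A' = emeasure N B'"
      using that by (intro inv) auto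
    ultimately have eq: "emeasure N A' = c * emeasure M A'" "emeasure N B' = c * emeasure M B'"
      using that by auto
    have "AE x in M. x \<in> A' \<longrightarrow> f x = c"
      using that eq by (intro nn_integral_indicator_eq_const_imp_AE) (auto simp: N emeasure_density)
    moreover have "AE x in M. x \<in> B' \<longrightarrow> f x = c"
      using that eq by (intro nn_integral_indicator_eq_const_imp_AE) (auto simp: N emeasure_density)
    ultimately show ?thesis by eventually_elim auto
  qed
  \<comment> \<open>\<open>str\<close> makes one of the two inequalities strict throughout its set,
    whereas \<open>sep\<close> forces \<open>f = c\<close> almost everywhere on subsets of positive
    mass of both.\<close>
  have no_sep: False
    if AB: "A \<in> sets M" "B \<in> sets M" "emeasure M A > 0" "emeasure M B > 0" "c < \<infinity>"
      and le: "\<And>x. x \<in> A \<Longrightarrow> f x \<le> c" and ge: "\<And>x. x \<in> B \<Longrightarrow> c \<le> f x"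
      and str: "c \<notin> f ` A \<or> c \<notin> f ` B" for A B c
  proof -
    obtain A' B' where *: "A' \<in> sets M" "B' \<in> sets M" "A' \<subseteq> A" "B' \<subseteq> B"
        "emeasure M A' = emeasure M B'" "0 < emeasure M A'" "emeasure M A' < \<infinity>"
        "emeasure N A' < \<infinity>" "emeasure N B' < \<infinity>"
      using atomless_equal_mass_subsets[OF atl sfM sfN sets AB(1-4)] .
    have ae: "AE x in M. x \<in> A' \<union> B' \<longrightarrow> f x = c"
      using * AB le ge by (intro sep) auto
    from str have "(AE x in M. x \<notin> A') \<or> (AE x in M. x \<notin> B')"
    proof
      assume "c \<notin> f ` A"
      from ae have "AE x in M. x \<notin> A'"
        by eventually_elim (use *(3) \<open>c \<notin> f ` A\<close> in auto)
      then show ?thesis ..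
    next
      assume "c \<notin> f ` B"
      from ae have "AE x in M. x \<notin> B'"
        by eventually_elim (use *(4) \<open>c \<notin> f ` B\<close> in auto)
      then show ?thesis ..
    qed
    then have "emeasure M A' = 0 \<or> emeasure M B' = 0"
      using *(1,2) by (auto simp flip: AE_iff_null_sets)
    then show False using * by auto
  qed
  have "\<exists>c::real. 0 \<le> c \<and> (AE x in M. f x = ennreal c)"
  proof (cases "emeasure M (space M) = 0")
    case True
    then have "AE x in M. f x = ennreal 0"
      by (intro AE_I[where N = "space M"]) auto
    then show ?thesis by blast
  next
    case False
    then obtain A where A: "A \<in> sets M" "emeasure M A > 0" "emeasure M A < \<infinity>" "emeasure N A < \<infinity>"
      using sigma_finite_positive_subset2[OF sfM sfN sets, of "space M"]
      by (auto simp: zero_less_iff_neq_zero)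
    \<comment> \<open>The mean of \<open>f\<close> over \<open>A\<close>; it is finite since
      \<open>A\<close> has positive \<open>M\<close>-mass and finite \<open>N\<close>-mass.\<close>
    define c where "c = emeasure N A / emeasure M A"
    have c: "c < \<infinity>"
      using A by (simp add: c_def divide_less_ennreal ennreal_top_mult)
    have cA: "emeasure N A = c * emeasure M A"
      using A by (simp add: c_def ennreal_divide_times)
    \<comment> \<open>If \<open>f\<close> stays on one side of its mean \<open>c\<close>, it equals
      \<open>c\<close> almost everywhere on \<open>A\<close>, so the level set has at least the mass
      of \<open>A\<close>.\<close>
    have on_A: "emeasure M {x\<in>space M. f x = c} > 0"
      if "(AE x in M. f x \<le> c) \<or> (AE x in M. c \<le> f x)"
    proof -
      have "(AE x in M. x \<in> A \<longrightarrow> f x \<le> c) \<or> (AE x in M. x \<in> A \<longrightarrow> c \<le> f x)"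
        using that by (elim disj_forward eventually_mono) blast+
      then have "AE x in M. x \<in> A \<longrightarrow> f x = c"
        using A c cA by (intro nn_integral_indicator_eq_const_imp_AE) (auto simp: N emeasure_density)
      then have "emeasure M A \<le> emeasure M {x\<in>space M. f x = c}"
        using sets.sets_into_space[OF A(1)] by (intro emeasure_mono_AE) (auto elim!: eventually_mono)
      with A show ?thesis by (auto intro: order.strict_trans2)
    qed
    have null_AE: "AE x in M. \<not> Q x" if "emeasure M {x\<in>space M. Q x} = 0"
        "{x\<in>space M. Q x} \<in> sets M" for Q
      using that by (intro AE_I[where N = "{x\<in>space M. Q x}"]) auto
    \<comment> \<open>If \<open>{f < c}\<close> had positive mass, \<open>no_sep\<close> would make
      \<open>{c \<le> f}\<close> null. Then \<open>f \<le> c\<close> almost everywhere, and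
      \<open>on_A\<close> gives positive mass to \<open>{f = c}\<close>, a subset of that null
      set.\<close>
    have lt0: "emeasure M {x\<in>space M. f x < c} = 0"
    proof (rule ccontr)
      assume lt: "emeasure M {x\<in>space M. f x < c} \<noteq> 0"
      have ge0: "emeasure M {x\<in>space M. c \<le> f x} = 0"
      proof (rule ccontr)
        assume "emeasure M {x\<in>space M. c \<le> f x} \<noteq> 0"
        then show False
          by (intro no_sep[of "{x\<in>space M. f x < c}" "{x\<in>space M. c \<le> f x}" c])
            (use lt c in \<open>auto simp: zero_less_iff_neq_zero\<close>)
      qed
      have "AE x in M. f x \<le> c"
        using null_AE[OF ge0] by (auto elim!: eventually_mono)
      then have "emeasure M {x\<in>space M. f x = c} > 0"
        using on_A by blast
      moreover have "emeasure M {x\<in>space M. f x = c} \<le> emeasure M {x\<in>space M. c \<le> f x}"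
        by (intro emeasure_mono) auto
      ultimately show False using ge0 by simp
    qed
    have ge: "AE x in M. c \<le> f x"
      using null_AE[OF lt0] by (auto elim!: eventually_mono)
    \<comment> \<open>By \<open>ge\<close> and \<open>on_A\<close> the level set
      \<open>{f = c}\<close> has positive mass, so it can serve as the lower set in
      \<open>no_sep\<close>.\<close>
    have gt0: "emeasure M {x\<in>space M. c < f x} = 0"
    proof (rule ccontr)
      assume gt: "emeasure M {x\<in>space M. c < f x} \<noteq> 0"
      have "emeasure M {x\<in>space M. f x = c} > 0"
        using ge on_A by blast
      then show False
        by (intro no_sep[of "{x\<in>space M. f x = c}" "{x\<in>space M. c < f x}" c])
          (use gt c in \<open>auto simp: zero_less_iff_neq_zero\<close>)
    qed
    have "AE x in M. \<not> c < f x"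
      by (rule null_AE[OF gt0]) simp
    with ge have "AE x in M. f x = ennreal (enn2real c)"
      by eventually_elim (use c in \<open>auto simp: less_top\<close>)
    then show ?thesis by (intro exI[of _ "enn2real c"]) auto
  qed
  then obtain c :: real where c: "0 \<le> c" "AE x in M. f x = ennreal c" by blast
  have "N = density M (\<lambda>_. ennreal c)"
    unfolding N using c by (intro density_cong) auto
  also have "\<dots> = scale_measure (ennreal c) M"
    by (intro measure_eqI) (auto simp: emeasure_density nn_integral_cmult)
  finally show ?thesis using c by blast
qed

section \<open>Application to the random measure\<close>

text \<open>Finite expectation makes the mass of \<open>A\<close> almost surely finite, so the
  default value 0 that \<open>measure\<close> takes at infinite mass occurs only on a null
  event.\<close>

lemma expectation_measure_random_measure:
  assumes "random_measure P \<mu> \<xi>" "A \<in> sets \<mu>" "emeasure (intensity P \<mu> \<xi>) A < \<infinity>"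
  shows "(\<integral>\<^sup>+\<omega>. ennreal (measure (\<xi> \<omega>) A) \<partial>P) = emeasure (intensity P \<mu> \<xi>) A"
proof -
  have "AE \<omega> in P. emeasure (\<xi> \<omega>) A \<noteq> \<infinity>"
    using assms by (intro nn_integral_PInf_AE) (auto simp: random_measure_def emeasure_intensity)
  then have "(\<integral>\<^sup>+\<omega>. ennreal (measure (\<xi> \<omega>) A) \<partial>P) = (\<integral>\<^sup>+\<omega>. emeasure (\<xi> \<omega>) A \<partial>P)"
    by (intro nn_integral_cong_AE) (auto elim!: eventually_mono simp: emeasure_eq_ennreal_measure)
  then show ?thesis using assms by (simp add: emeasure_intensity)
qed

theorem theorem2p15:
  fixes \<mu> :: "'a measure" and P :: "'w measure" and \<xi> :: "'w \<Rightarrow> 'a measure"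
  assumes "atomless \<mu>" and "sigma_finite_measure \<mu>"
    and "random_measure P \<mu> \<xi>" and "swap_invariant P \<mu> \<xi>"
    and "sigma_finite_measure (intensity P \<mu> \<xi>)"
  shows "\<exists>c::real. 0 \<le> c \<and> intensity P \<mu> \<xi> = scale_measure (ennreal c) \<mu>"
proof (rule equal_mass_invariant_imp_scale_measure[OF assms(1,2,5) sets_intensity])
  fix A B assume AB: "A \<in> sets \<mu>" "B \<in> sets \<mu>" "emeasure \<mu> A = emeasure \<mu> B"
    "emeasure (intensity P \<mu> \<xi>) A < \<infinity>" "emeasure (intensity P \<mu> \<xi>) B < \<infinity>"
  \<comment> \<open>With \<open>n = 1\<close> and \<open>u = 1\<close> the constant families are
    trivially disjoint over the single index, and the absolute value is that of a nonnegative
    number, so both sides are the intensities.\<close>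
  have "(\<integral>\<^sup>+\<omega>. ennreal \<bar>\<Sum>j=1..1::nat. 1 * measure (\<xi> \<omega>) A\<bar> \<partial>P) =
        (\<integral>\<^sup>+\<omega>. ennreal \<bar>\<Sum>j=1..1::nat. 1 * measure (\<xi> \<omega>) B\<bar> \<partial>P)"
    using assms(4)[unfolded swap_invariant_def, rule_format,
        of "1::nat" "\<lambda>_. A" "\<lambda>_. B" "\<lambda>_. 1"] AB assms(3)
    by (simp add: emeasure_intensity disjoint_family_on_def)
  then show "emeasure (intensity P \<mu> \<xi>) A = emeasure (intensity P \<mu> \<xi>) B"
    using AB assms(3) by (simp add: expectation_measure_random_measure)
qed

end
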